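(* Let $L=HFL_{2k_1+1,2k_2+1,\dots,2k_s+1}$ be a generalized Heisenberg-Fock Leibniz algebra over $\mathbb{F}$, i.e. a Leibniz algebra with $L/I\cong H_{2k_1+1}\oplus\cdots\oplus H_{2k_s+1}$ and with $I\cong\mathbb{F}[x_1,\dots,x_n]$, $n=k_1+\cdots+k_s$, as $L/I$-module, where the action is the one induced by the Fock representations as described in the context. Put $\mathcal{B}_i=\{\overline{1_i},\overline{x_{1,i}},\dots,\overline{x_{k_i,i}},\frac{\overline{\delta}}{\delta x_{1,i}},\dots,\frac{\overline{\delta}}{\delta x_{k_i,i}}\}$. Then $L$ admits a basis $$\mathcal{B}_1\,\dot\cup\,\mathcal{B}_2\,\dot\cup\cdots\dot\cup\,\mathcal{B}_s\,\dot\cup\,\{x_1^{t_1}x_2^{t_2}\cdots x_n^{t_n}\mid t_i\in\mathbb{N}\cup\{0\},\ 1\le i\le n\}$$ in which, writing $N(i,j)=k_1+\cdots+k_{i-1}+j$, the multiplication table is, for $1\le i\le s$ and $1\le j\le k_i$, $$[\overline{x_{j,i}},\tfrac{\overline{\delta}}{\delta x_{j,i}}]=\overline{1_i},\qquad [\tfrac{\overline{\delta}}{\delta x_{j,i}},\overline{x_{j,i}}]=-\overline{1_i},$$ $$[x_1^{t_1}\cdots x_n^{t_n},\overline{1_i}]=x_1^{t_1}\cdots x_n^{t_n},$$ $$[x_1^{t_1}\cdots x_n^{t_n},\overline{x_{j,i}}]=x_1^{t_1}\cdots x_{N(i,j)-1}^{t_{N(i,j)-1}}\,x_{N(i,j)}^{t_{N(i,j)}+1}\,x_{N(i,j)+1}^{t_{N(i,j)+1}}\cdots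 x_n^{t_n},$$ $$[x_1^{t_1}\cdots x_n^{t_n},\tfrac{\overline{\delta}}{\delta x_{j,i}}]=t_{N(i,j)}\,x_1^{t_1}\cdots x_{N(i,j)-1}^{t_{N(i,j)-1}}\,x_{N(i,j)}^{t_{N(i,j)}-1}\,x_{N(i,j)+1}^{t_{N(i,j)+1}}\cdots x_n^{t_n},$$ where all omitted products of basis elements are zero.
   Context: $\mathbb{F}$ is an algebraically closed field of characteristic zero. A Leibniz algebra is an $\mathbb{F}$-vector space $L$ with a bilinear product $[\cdot,\cdot]$ satisfying $[[y,z],x]=[[y,x],z]+[y,[z,x]]$ for all $x,y,z\in L$. $I$ denotes the ideal of $L$ generated by $\{[x,x]:x\in L\}$; it satisfies $[L,I]=0$, the quotient $L/I$ is a Lie algebra (the corresponding Lie algebra of $L$), and $I$ is a (right) $L/I$-module via $(i,[x])\mapsto [i,x]$. The Heisenberg algebra $H_{2k_i+1}$ is the Lie algebra with standard basis $\{\overline{1_i},\overline{x_{1,i}},\dots,\overline{x_{k_i,i}},\frac{\overline{\delta}}{\delta x_{1,i}},\dots,\frac{\overline{\delta}}{\delta x_{k_i,i}}\}$ and nonzero products $[\overline{x_{j,i}},\frac{\overline{\delta}}{\delta x_{j,i}}]=-[\frac{\overline{\delta}}{\delta x_{j,i}},\overline{x_{j,i}}]=\overline{1_i}$. The action of $H_{2k_1+1}\oplus\cdots\oplus H_{2k_s+1}$ on $\mathbb{F}[x_1,\dots,x_n]$ is $$(p,\overline{1_i})\mapsto p,\quad (p,\overline{x_{j,i}})\mapsto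 p\,x_{k_1+\cdots+k_{i-1}+j},\quad (p,\tfrac{\overline{\delta}}{\delta x_{j,i}})\mapsto \tfrac{\delta}{\delta x_{k_1+\cdots+k_{i-1}+j}}p,$$ for $1\le i\le s$, $1\le j\le k_i$ (the last being the partial derivative). In the multiplication table, terms with coefficient $t_{N(i,j)}=0$ are zero. *)

theory Defs
  imports "HOL-Library.Poly_Mapping" "HOL-Library.FuncSet"
    "HOL-Computational_Algebra.Polynomial"
begin

record ('f, 'a) alg =
  carr :: "'a set"
  add :: "'a \<Rightarrow> 'a \<Rightarrow> 'a"
  smul :: "'f \<Rightarrow> 'a \<Rightarrow> 'a"
  prd :: "'a \<Rightarrow> 'a \<Rightarrow> 'a"

definition alg_iso :: "('f, 'a) alg \<Rightarrow> ('f, 'b) alg \<Rightarrow> ('a \<Rightarrow> 'b) \<Rightarrow> bool" where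
  "alg_iso A B \<phi> \<longleftrightarrow>
     bij_betw \<phi> (carr A) (carr B) \<and>
     (\<forall>x\<in>carr A. \<forall>y\<in>carr A. \<phi> (add A x y) = add B (\<phi> x) (\<phi> y)) \<and>
     (\<forall>c. \<forall>x\<in>carr A. \<phi> (smul A c x) = smul B c (\<phi> x)) \<and>
     (\<forall>x\<in>carr A. \<forall>y\<in>carr A. \<phi> (prd A x y) = prd B (\<phi> x) (\<phi> y))"

definition direct_sum_alg :: "'i set \<Rightarrow> ('i \<Rightarrow> ('f, 'a) alg) \<Rightarrow> ('f, 'i \<Rightarrow> 'a) alg" where
  \<comment> \<open>only used for finite \<open>S\<close>, where direct sum and direct product coincide\<close>
  "direct_sum_alg S A =
     \<lparr>carr = (\<Pi>\<^sub>E i\<in>S. carr (A i)),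
      add = (\<lambda>u v. \<lambda>i\<in>S. add (A i) (u i) (v i)),
      smul = (\<lambda>c u. \<lambda>i\<in>S. smul (A i) c (u i)),
      prd = (\<lambda>u v. \<lambda>i\<in>S. prd (A i) (u i) (v i))\<rparr>"

locale leibniz_algebra = vector_space scale
  for scale :: "'f::field \<Rightarrow> 'v::ab_group_add \<Rightarrow> 'v" +
  fixes bracket :: "'v \<Rightarrow> 'v \<Rightarrow> 'v"
  assumes bracket_linear_left: "Vector_Spaces.linear scale scale (\<lambda>x. bracket x y)"
    and bracket_linear_right: "Vector_Spaces.linear scale scale (\<lambda>y. bracket x y)"
    and leibniz: "bracket (bracket y z) x = bracket (bracket y x) z + bracket y (bracket z x)"
begin

definition ideal :: "'v set \<Rightarrow> bool" where
  "ideal J \<longleftrightarrow> subspace J \<and> (\<forall>x. \<forall>y\<in>J. bracket x y \<in> J \<and> bracket y x \<in> J)"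

definition leib :: "'v set" where
  "leib = ideal hull {bracket x x | x. True}"

definition coset :: "'v \<Rightarrow> 'v set" where
  "coset x = (\<lambda>i. x + i) ` leib"

definition lie_quotient :: "('f, 'v set) alg" where
  \<comment> \<open>each union below is over representatives; it is a single coset because \<open>leib\<close> is an ideal\<close>
  "lie_quotient =
     \<lparr>carr = range coset,
      add = (\<lambda>X Y. \<Union>x\<in>X. \<Union>y\<in>Y. coset (x + y)),
      smul = (\<lambda>c X. \<Union>x\<in>X. coset (scale c x)),
      prd = (\<lambda>X Y. \<Union>x\<in>X. \<Union>y\<in>Y. coset (bracket x y))\<rparr>"

lemma ideal_leib: "ideal leib"
  unfolding leib_def
proof (rule hull_in)
  fix F assume F: "\<forall>J\<in>F. ideal J"
  have "subspace (\<Inter>F)"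
    using F by (intro subspace_Inter) (simp add: ideal_def)
  moreover have "bracket x y \<in> \<Inter>F \<and> bracket y x \<in> \<Inter>F" if "y \<in> \<Inter>F" for x y
    using F that by (simp add: ideal_def)
  ultimately show "ideal (\<Inter>F)"
    by (simp add: ideal_def)
qed

lemma coset_eq_iff: "coset x = coset y \<longleftrightarrow> x - y \<in> leib"
proof
  have s: "subspace leib" using ideal_leib by (simp add: ideal_def)
  show "x - y \<in> leib" if c: "coset x = coset y"
  proof -
    have "x + 0 \<in> coset x" unfolding coset_def using subspace_0[OF s] by (rule imageI)
    then obtain i where "i \<in> leib" "x + 0 = y + i" unfolding c unfolding coset_def by (rule imageE)
    then show ?thesis by simp
  qed
  show "coset x = coset y" if d: "x - y \<in> leib"
  proof (intro equalityI subsetI)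
    fix z assume "z \<in> coset x"
    then obtain i where i: "i \<in> leib" "z = x + i" unfolding coset_def by blast
    have "z = y + ((x - y) + i)" using i by simp
    then show "z \<in> coset y" unfolding coset_def using subspace_add[OF s d i(1)] by (rule image_eqI)
  next
    fix z assume "z \<in> coset y"
    then obtain i where i: "i \<in> leib" "z = y + i" unfolding coset_def by blast
    have "z = x + (i - (x - y))" using i by simp
    then show "z \<in> coset x" unfolding coset_def using subspace_diff[OF s i(1) d] by (rule image_eqI)
  qed
qed

lemma mem_coset_iff: "y \<in> coset x \<longleftrightarrow> coset y = coset x"
proof -
  have "y \<in> coset x \<longleftrightarrow> y - x \<in> leib"
  proof
    assume "y \<in> coset x"
    then obtain i where "i \<in> leib" "y = x + i" unfolding coset_def by (rule imageE)
    then show "y - x \<in> leib" by simp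
  next
    assume "y - x \<in> leib"
    then have "x + (y - x) \<in> coset x" unfolding coset_def by (rule imageI)
    then show "y \<in> coset x" by simp
  qed
  then show ?thesis by (simp add: coset_eq_iff)
qed

lemma coset_nonempty: "coset x \<noteq> {}"
proof -
  have "x \<in> coset x" by (simp add: mem_coset_iff)
  then show ?thesis by auto
qed

lemma lie_quotient_add: "add lie_quotient (coset x) (coset y) = coset (x + y)"
proof -
  have s: "subspace leib" using ideal_leib by (simp add: ideal_def)
  have "coset (x' + y') = coset (x + y)" if "x' \<in> coset x" "y' \<in> coset y" for x' y'
    using that subspace_add[OF s, of "x' - x" "y' - y"]
    by (simp add: mem_coset_iff coset_eq_iff algebra_simps)
  moreover note coset_nonempty
  ultimately show ?thesis by (simp add: lie_quotient_def)
qed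

lemma lie_quotient_smul: "smul lie_quotient c (coset x) = coset (scale c x)"
proof -
  have s: "subspace leib" using ideal_leib by (simp add: ideal_def)
  have "coset (scale c x') = coset (scale c x)" if "x' \<in> coset x" for x'
    using that subspace_scale[OF s, of "x' - x" c]
    by (simp add: mem_coset_iff coset_eq_iff scale_right_diff_distrib)
  moreover note coset_nonempty
  ultimately show ?thesis by (simp add: lie_quotient_def)
qed

lemma lie_quotient_prd: "prd lie_quotient (coset x) (coset y) = coset (bracket x y)"
proof -
  have s: "subspace leib" using ideal_leib by (simp add: ideal_def)
  have dl: "bracket (a - b) z = bracket a z - bracket b z" for a b z
    using bracket_linear_left by (rule module_hom.diff[OF Vector_Spaces.linear.axioms(3)])
  have dr: "bracket z (a - b) = bracket z a - bracket z b" for a b z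
    using bracket_linear_right by (rule module_hom.diff[OF Vector_Spaces.linear.axioms(3)])
  have "coset (bracket x' y') = coset (bracket x y)" if "x' \<in> coset x" "y' \<in> coset y" for x' y'
  proof -
    have "x' - x \<in> leib" "y' - y \<in> leib" using that by (simp_all add: mem_coset_iff coset_eq_iff)
    then have "bracket (x' - x) y' + bracket x (y' - y) \<in> leib"
      using ideal_leib subspace_add[OF s] by (simp add: ideal_def)
    then show ?thesis by (simp add: coset_eq_iff dl dr)
  qed
  moreover note coset_nonempty
  ultimately show ?thesis by (simp add: lie_quotient_def)
qed

end

text \<open>
  The standard basis of the Heisenberg algebra of dimension \<open>2 * k + 1\<close> consists of the central
  element \<open>One\<close>, the \<open>X j\<close> and the \<open>D j\<close> (the latter standing for the partial derivatives),
  with \<open>1 \<le> j \<le> k\<close>. Vectors are coordinate functions with respect to it.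
\<close>

datatype heis_ix = One | X nat | D nat

definition heis_basis :: "nat \<Rightarrow> heis_ix set" where
  "heis_basis k = {One} \<union> X ` {1..k} \<union> D ` {1..k}"

definition unit_vec :: "heis_ix \<Rightarrow> heis_ix \<Rightarrow> 'f::field" where
  "unit_vec b = (\<lambda>c. if c = b then 1 else 0)"

fun heis_table :: "heis_ix \<Rightarrow> heis_ix \<Rightarrow> heis_ix \<Rightarrow> 'f::field" where
  "heis_table (X j) (D l) = (if j = l then unit_vec One else (\<lambda>_. 0))"
| "heis_table (D l) (X j) = (if j = l then (\<lambda>c. - unit_vec One c) else (\<lambda>_. 0))"
| "heis_table _ _ = (\<lambda>_. 0)"

definition heisenberg :: "nat \<Rightarrow> ('f::field, heis_ix \<Rightarrow> 'f) alg" where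
  "heisenberg k =
     \<lparr>carr = {v. \<forall>b. b \<notin> heis_basis k \<longrightarrow> v b = 0},
      add = (\<lambda>v w b. v b + w b),
      smul = (\<lambda>c v b. c * v b),
      prd = (\<lambda>v w c. \<Sum>a\<in>heis_basis k. \<Sum>b\<in>heis_basis k. v a * w b * heis_table a b c)\<rparr>"

definition heisenberg_sum ::
    "nat \<Rightarrow> (nat \<Rightarrow> nat) \<Rightarrow> ('f::field, nat \<Rightarrow> heis_ix \<Rightarrow> 'f) alg" where
  "heisenberg_sum s k = direct_sum_alg {1..s} (\<lambda>i. heisenberg (k i))"

text \<open>
  The exponent vector of a monomial is a finitely supported function \<open>nat \<Rightarrow>\<^sub>0 nat\<close>, and a
  polynomial is a finitely supported function from exponent vectors to coefficients; the library's
  product on this type is polynomial multiplication. Variables are numbered from 1.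
\<close>

type_synonym 'f mpol = "(nat \<Rightarrow>\<^sub>0 nat) \<Rightarrow>\<^sub>0 'f"

definition exponents :: "nat \<Rightarrow> (nat \<Rightarrow>\<^sub>0 nat) set" where
  "exponents n = {t. Poly_Mapping.keys t \<subseteq> {1..n}}"

definition polys :: "nat \<Rightarrow> 'f::field mpol set" where
  "polys n = {p. Poly_Mapping.keys p \<subseteq> exponents n}"

definition pscale :: "'f::field \<Rightarrow> 'f mpol \<Rightarrow> 'f mpol" where
  "pscale c p = Poly_Mapping.single 0 c * p"

definition pvar :: "nat \<Rightarrow> 'f::field mpol" where
  "pvar m = Poly_Mapping.single (Poly_Mapping.single m 1) 1"

definition partial :: "nat \<Rightarrow> 'f::field mpol \<Rightarrow> 'f mpol" where
  \<comment> \<open>subtraction of exponents truncates, but only where the coefficient is zero\<close>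
  "partial m p = (\<Sum>t\<in>Poly_Mapping.keys p.
     Poly_Mapping.single (t - Poly_Mapping.single m 1)
       (of_nat (Poly_Mapping.lookup t m) * Poly_Mapping.lookup p t))"

lemma partial_single:
  "partial m (Poly_Mapping.single t c) =
     Poly_Mapping.single (t - Poly_Mapping.single m 1) (of_nat (Poly_Mapping.lookup t m) * c)"
  by (cases "c = 0") (simp_all add: partial_def)

definition var_ix :: "(nat \<Rightarrow> nat) \<Rightarrow> nat \<Rightarrow> nat \<Rightarrow> nat" where
  "var_ix k i j = (\<Sum>l\<in>{1..<i}. k l) + j"

fun fock_gen :: "(nat \<Rightarrow> nat) \<Rightarrow> nat \<Rightarrow> 'f::field mpol \<Rightarrow> heis_ix \<Rightarrow> 'f mpol" where
  "fock_gen k i p One = p"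
| "fock_gen k i p (X j) = p * pvar (var_ix k i j)"
| "fock_gen k i p (D j) = partial (var_ix k i j) p"

definition fock ::
    "nat \<Rightarrow> (nat \<Rightarrow> nat) \<Rightarrow> 'f::field mpol \<Rightarrow> (nat \<Rightarrow> heis_ix \<Rightarrow> 'f) \<Rightarrow> 'f mpol" where
  "fock s k p v = (\<Sum>i\<in>{1..s}. \<Sum>b\<in>heis_basis (k i). pscale (v i b) (fock_gen k i p b))"

locale heisenberg_fock = leibniz_algebra scale bracket
  for scale :: "'f::field \<Rightarrow> 'v::ab_group_add \<Rightarrow> 'v" and bracket :: "'v \<Rightarrow> 'v \<Rightarrow> 'v" +
  fixes s :: nat and k :: "nat \<Rightarrow> nat"
  assumes quotient_and_module_iso:
    "\<exists>\<phi> \<psi>. alg_iso lie_quotient (heisenberg_sum s k) \<phi> \<and>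
       bij_betw \<psi> leib (polys (\<Sum>i\<in>{1..s}. k i)) \<and>
       (\<forall>u\<in>leib. \<forall>v\<in>leib. \<psi> (u + v) = \<psi> u + \<psi> v) \<and>
       (\<forall>c. \<forall>u\<in>leib. \<psi> (scale c u) = pscale c (\<psi> u)) \<and>
       (\<forall>u\<in>leib. \<forall>x. \<psi> (bracket u x) = fock s k (\<psi> u) (\<phi> (coset x)))"

datatype hfl_ix = H nat heis_ix | Mon "nat \<Rightarrow>\<^sub>0 nat"

definition hfl_basis :: "nat \<Rightarrow> (nat \<Rightarrow> nat) \<Rightarrow> hfl_ix set" where
  "hfl_basis s k =
     (\<Union>i\<in>{1..s}. H i ` heis_basis (k i)) \<union> Mon ` exponents (\<Sum>i\<in>{1..s}. k i)"

definition hfl_table :: "('f::field \<Rightarrow> 'v::ab_group_add \<Rightarrow> 'v) \<Rightarrow> (nat \<Rightarrow> nat) \<Rightarrow> (hfl_ix \<Rightarrow> 'v) \<Rightarrow>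
    hfl_ix \<Rightarrow> hfl_ix \<Rightarrow> 'v" where
  "hfl_table scale k e a b =
     (case (a, b) of
        (H i (X j), H i' (D j')) \<Rightarrow> if i = i' \<and> j = j' then e (H i One) else 0
      | (H i (D j), H i' (X j')) \<Rightarrow> if i = i' \<and> j = j' then - e (H i One) else 0
      | (Mon t, H i One) \<Rightarrow> e (Mon t)
      | (Mon t, H i (X j)) \<Rightarrow> e (Mon (t + Poly_Mapping.single (var_ix k i j) 1))
      | (Mon t, H i (D j)) \<Rightarrow>
          scale (of_nat (Poly_Mapping.lookup t (var_ix k i j)))
            (e (Mon (t - Poly_Mapping.single (var_ix k i j) 1)))
      | _ \<Rightarrow> 0)"

end

theory Submission
  imports Defs
begin

text \<open>
  Let \<open>c\<close> be a lift of \<open>\<one>\<^sub>1\<close>, which exists because \<open>s = 0\<close> would make \<open>L = I\<close>, hence \<open>L\<close> abelian and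
  \<open>I = 0\<close>. As \<open>\<one>\<^sub>1\<close> is central in \<open>L/I\<close> and acts as the identity on \<open>I\<close>, right multiplication by \<open>c\<close>
  is a projection of \<open>L\<close> onto \<open>I\<close>. Since \<open>[L, I] = 0\<close>, the Leibniz identity shows that this projection
  commutes with all right multiplications, so its kernel is a subalgebra complementing \<open>I\<close>. The lifts
  of the standard basis of \<open>L/I\<close> to this kernel therefore multiply exactly as in \<open>L/I\<close>.
\<close>

text \<open>If \<open>e a\<close> lay in the span of the other vectors, \<open>f a\<close> would
  vanish on it, whereas its value there is 1. Linearity is asked of \<open>f a\<close> for
  \<open>a\<close> in \<open>B\<close> only, because coordinates in summands outside
  \<open>{1..s}\<close> will be unspecified.\<close>

lemma (in vector_space) dual_family_imp_independent:
  fixes e :: "'i \<Rightarrow> 'b" and f :: "'i \<Rightarrow> 'b \<Rightarrow> 'a"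
  assumes add: "\<And>a x y. a \<in> B \<Longrightarrow> f a (x + y) = f a x + f a y"
    and scale: "\<And>a r x. a \<in> B \<Longrightarrow> f a (scale r x) = r * f a x"
    and dual: "\<And>a b. a \<in> B \<Longrightarrow> b \<in> B \<Longrightarrow> f a (e b) = (if a = b then 1 else 0)"
  shows "inj_on e B" "independent (e ` B)"
proof -
  show "inj_on e B"
    by (rule inj_onI) (metis dual zero_neq_one)
  show "independent (e ` B)"
    unfolding dependent_def
  proof safe
    fix a assume a: "a \<in> B" and sp: "e a \<in> span (e ` B - {e a})"
    have "f a 0 = 0" using scale[OF a, of 0 0] by simp
    then have "subspace {x. f a x = 0}"
      by (simp add: subspace_def add[OF a] scale[OF a])
    moreover have "e ` B - {e a} \<subseteq> {x. f a x = 0}"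
      using dual[OF a] by auto
    ultimately have "f a (e a) = 0" using span_minimal sp by blast
    then show False using dual[OF a a] by simp
  qed
qed

section \<open>Bilinearity and the right annihilator\<close>

context leibniz_algebra
begin

lemma bracket_add_left: "bracket (x + y) z = bracket x z + bracket y z"
  using bracket_linear_left by (rule module_hom.add[OF Vector_Spaces.linear.axioms(3)])

lemma bracket_add_right: "bracket z (x + y) = bracket z x + bracket z y"
  using bracket_linear_right by (rule module_hom.add[OF Vector_Spaces.linear.axioms(3)])

lemma bracket_diff_left: "bracket (x - y) z = bracket x z - bracket y z"
  using bracket_linear_left by (rule module_hom.diff[OF Vector_Spaces.linear.axioms(3)])

lemma bracket_scale_left: "bracket (scale r x) z = scale r (bracket x z)"
  using bracket_linear_left by (rule module_hom.scale[OF Vector_Spaces.linear.axioms(3)])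

lemma bracket_scale_right: "bracket z (scale r x) = scale r (bracket z x)"
  using bracket_linear_right by (rule module_hom.scale[OF Vector_Spaces.linear.axioms(3)])

lemma bracket_zero_left: "bracket 0 z = 0"
  using bracket_diff_left[of 0 0 z] by simp

lemma bracket_zero_right: "bracket z 0 = 0"
  using bracket_scale_right[of z 0 0] by simp

lemma subspace_leib: "subspace leib"
  using ideal_leib by (simp add: ideal_def)

lemma bracket_leib_left: "u \<in> leib \<Longrightarrow> bracket u x \<in> leib"
  using ideal_leib by (simp add: ideal_def)

lemma leib_minimal: "ideal J \<Longrightarrow> (\<And>x. bracket x x \<in> J) \<Longrightarrow> leib \<subseteq> J"
  unfolding leib_def by (rule hull_minimal) auto

text \<open>The right annihilator of the algebra is an ideal by the Leibniz identity. It contains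
  every square, since in \<open>[[y,z],z] = [[y,z],z] + [y,[z,z]]\<close> the last term must vanish.
  Minimality of \<open>leib\<close> does the rest.\<close>

lemma bracket_leib_right:
  assumes "u \<in> leib"
  shows "bracket x u = 0"
proof -
  have sq: "bracket y (bracket z z) = 0" for y z
    using leibniz[of y z z] by simp
  have "subspace {y. \<forall>x. bracket x y = 0}"
    by (simp add: subspace_def bracket_add_right bracket_scale_right bracket_zero_right)
  moreover have "bracket z (bracket x y) = 0" "bracket z (bracket y x) = 0"
    if "\<forall>x. bracket x y = 0" for x y z
    using that leibniz[of z x y] leibniz[of z y x] by (simp_all add: bracket_zero_left)
  ultimately have "ideal {y. \<forall>x. bracket x y = 0}"
    by (simp add: ideal_def)
  from leib_minimal[OF this] sq show ?thesis using assms by auto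
qed

text \<open>As \<open>leib\<close> annihilates from the right, the bracket is zero. Then
  \<open>{0}\<close> is an ideal containing all squares, which forces \<open>leib\<close> into
  it.\<close>

lemma leib_eq_UNIV_imp_trivial:
  assumes "leib = UNIV"
  shows "(x :: 'v) = 0"
proof -
  have "bracket y z = 0" for y z using bracket_leib_right assms by blast
  then have "leib \<subseteq> {0}"
    by (intro leib_minimal) (auto simp: ideal_def subspace_0 subspace_single_0)
  then show ?thesis using assms by auto
qed

end

section \<open>Right multiplication as a projection onto \<open>leib\<close>\<close>

locale leibniz_unit = leibniz_algebra +
  fixes c :: 'b
  assumes bracket_unit_leib: "u \<in> leib \<Longrightarrow> bracket u c = u"
    and bracket_unit_in_leib: "bracket x c \<in> leib"
begin

text \<open>The Leibniz identity has the further term \<open>[y,[z,c]]\<close>, which vanishes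
  because \<open>[z,c]\<close> lies in \<open>leib\<close>.\<close>

lemma bracket_unit_bracket: "bracket (bracket y z) c = bracket (bracket y c) z"
  using leibniz[of y z c] bracket_leib_right[OF bracket_unit_in_leib[of z]] by simp

lemma unit_complement: "bracket (x - bracket x c) c = 0"
  by (simp add: bracket_diff_left bracket_unit_leib bracket_unit_in_leib)

lemma unit_kernel_bracket: "bracket y c = 0 \<Longrightarrow> bracket (bracket y z) c = 0"
  by (simp add: bracket_unit_bracket bracket_zero_left)

text \<open>The kernel meets \<open>leib\<close> trivially: an element \<open>u\<close> of both
  satisfies \<open>u = [u,c] = 0\<close>. This is what turns congruences modulo \<open>leib\<close>
  into equations.\<close>

lemma unit_kernel_eqI:
  assumes "bracket x c = 0" "bracket y c = 0" "x - y \<in> leib"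
  shows "x = y"
  using bracket_unit_leib[OF assms(3)] assms(1,2) by (simp add: bracket_diff_left)

lemma subspace_unit_kernel: "subspace {x. bracket x c = 0}"
  by (simp add: subspace_def bracket_zero_left bracket_add_left bracket_scale_left)

end

section \<open>Polynomials, exponents and the numbering of the variables\<close>

lemma finite_heis_basis: "finite (heis_basis m)"
  by (simp add: heis_basis_def)

lemma pscale_1: "pscale 1 p = p"
  unfolding pscale_def by simp

lemma pscale_0: "pscale 0 p = 0"
  by (simp add: pscale_def)

lemma pscale_single: "pscale r (Poly_Mapping.single t a) = Poly_Mapping.single t (r * a)"
  by (simp add: pscale_def mult_single)

lemma lookup_pscale: "Poly_Mapping.lookup (pscale r p) t = r * Poly_Mapping.lookup p t"
  unfolding pscale_def mult_map_scale_conv_mult[symmetric]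
  by (simp add: Poly_Mapping.map.rep_eq when_def)

lemma poly_mapping_eq_sum_single:
  "p = (\<Sum>t\<in>Poly_Mapping.keys p. Poly_Mapping.single t (Poly_Mapping.lookup p t))"
  by (rule poly_mapping_eqI)
    (simp add: lookup_sum lookup_single when_def sum.delta' in_keys_iff)

lemma single_in_polys: "t \<in> exponents n \<Longrightarrow> Poly_Mapping.single t a \<in> polys n"
  by (simp add: polys_def)

lemma var_ix_in_range:
  assumes "i \<in> {1..s}" "j \<in> {1..k i}"
  shows "var_ix k i j \<in> {1..\<Sum>i\<in>{1..s}. k i}"
proof -
  have "(\<Sum>l\<in>{1..<i}. k l) + k i = sum k (insert i {1..<i})" by simp
  also have "\<dots> \<le> (\<Sum>i\<in>{1..s}. k i)"
    using assms by (intro sum_mono2) auto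
  finally show ?thesis using assms by (simp add: var_ix_def)
qed

lemma exponents_add_single: "t \<in> exponents n \<Longrightarrow> m \<in> {1..n} \<Longrightarrow> t + Poly_Mapping.single m 1 \<in> exponents n"
  using keys_add[of t "Poly_Mapping.single m 1"] by (auto simp: exponents_def)

text \<open>Truncated subtraction never enlarges the support.\<close>

lemma exponents_diff: "t \<in> exponents n \<Longrightarrow> t - r \<in> exponents n"
  by (auto simp: exponents_def in_keys_iff lookup_minus subset_iff)

text \<open>Meant for evaluating \<open>fock\<close> at a coordinate vector that is a single basis
  vector of a single summand.\<close>

lemma sum_sum_pscale_delta:
  assumes "finite S" "i \<in> S" "\<And>i. finite (B i)" "a \<in> B i"
  shows "(\<Sum>j\<in>S. \<Sum>b\<in>B j. pscale (if j = i \<and> b = a then 1 else 0) (g j b)) = g i a"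
proof -
  have "(\<Sum>j\<in>S. \<Sum>b\<in>B j. pscale (if j = i \<and> b = a then 1 else 0) (g j b))
      = (\<Sum>j\<in>S. if j = i then g i a else 0)"
  proof (rule sum.cong[OF refl])
    fix j
    have "(\<Sum>b\<in>B j. pscale (if j = i \<and> b = a then 1 else 0) (g j b))
      = (\<Sum>b\<in>B j. if b = a then if j = i then g i a else 0 else 0)"
      by (rule sum.cong) (auto simp: pscale_0 pscale_1)
    then show "(\<Sum>b\<in>B j. pscale (if j = i \<and> b = a then 1 else 0) (g j b))
        = (if j = i then g i a else 0)"
      using assms by (auto simp: sum.delta)
  qed
  then show ?thesis using assms by (simp add: sum.delta)
qed

section \<open>Coordinates with respect to fixed isomorphisms\<close>

locale heisenberg_fock_iso = leibniz_algebra scale bracket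
  for scale :: "'f::field \<Rightarrow> 'v::ab_group_add \<Rightarrow> 'v" and bracket :: "'v \<Rightarrow> 'v \<Rightarrow> 'v" +
  fixes s :: nat and k :: "nat \<Rightarrow> nat"
    and \<phi> :: "'v set \<Rightarrow> nat \<Rightarrow> heis_ix \<Rightarrow> 'f" and \<psi> :: "'v \<Rightarrow> 'f mpol"
  assumes phi_iso: "alg_iso lie_quotient (heisenberg_sum s k) \<phi>"
    and psi_bij: "bij_betw \<psi> leib (polys (\<Sum>i\<in>{1..s}. k i))"
    and psi_add: "u \<in> leib \<Longrightarrow> v \<in> leib \<Longrightarrow> \<psi> (u + v) = \<psi> u + \<psi> v"
    and psi_scale: "u \<in> leib \<Longrightarrow> \<psi> (scale r u) = pscale r (\<psi> u)"
    and psi_bracket: "u \<in> leib \<Longrightarrow> \<psi> (bracket u x) = fock s k (\<psi> u) (\<phi> (coset x))"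
begin

text \<open>Coordinates of the class of \<open>x\<close> in the quotient. The value is meaningful
  only for a summand index in \<open>{1..s}\<close>, because elements of the direct sum are
  extensional functions.\<close>

definition coord :: "'v \<Rightarrow> nat \<Rightarrow> heis_ix \<Rightarrow> 'f" where
  "coord x = \<phi> (coset x)"

lemma carr_lie_quotient: "carr lie_quotient = range coset"
  by (simp add: lie_quotient_def)

lemma coord_add: "i \<in> {1..s} \<Longrightarrow> coord (x + y) i b = coord x i b + coord y i b"
proof -
  assume i: "i \<in> {1..s}"
  have "\<phi> (add lie_quotient (coset x) (coset y))
      = add (heisenberg_sum s k) (\<phi> (coset x)) (\<phi> (coset y))"
    using phi_iso by (simp add: alg_iso_def carr_lie_quotient)
  then show ?thesis using i
    by (simp add: coord_def lie_quotient_add heisenberg_sum_def direct_sum_alg_def heisenberg_def)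
qed

lemma coord_scale: "i \<in> {1..s} \<Longrightarrow> coord (scale r x) i b = r * coord x i b"
proof -
  assume i: "i \<in> {1..s}"
  have "\<phi> (smul lie_quotient r (coset x)) = smul (heisenberg_sum s k) r (\<phi> (coset x))"
    using phi_iso by (simp add: alg_iso_def carr_lie_quotient)
  then show ?thesis using i
    by (simp add: coord_def lie_quotient_smul heisenberg_sum_def direct_sum_alg_def heisenberg_def)
qed

lemma coord_bracket:
  assumes i: "i \<in> {1..s}"
  shows "coord (bracket x y) i d = (\<Sum>a\<in>heis_basis (k i). \<Sum>b\<in>heis_basis (k i).
    coord x i a * coord y i b * heis_table a b d)"
proof -
  have "\<phi> (prd lie_quotient (coset x) (coset y))
      = prd (heisenberg_sum s k) (\<phi> (coset x)) (\<phi> (coset y))"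
    using phi_iso by (simp add: alg_iso_def carr_lie_quotient)
  then show ?thesis using i
    by (simp add: coord_def lie_quotient_prd heisenberg_sum_def direct_sum_alg_def heisenberg_def)
qed

lemma phi_coset_in_carr: "\<phi> (coset x) \<in> carr (heisenberg_sum s k)"
  using phi_iso by (auto simp: alg_iso_def carr_lie_quotient bij_betw_def)

lemma coord_outside: "i \<in> {1..s} \<Longrightarrow> b \<notin> heis_basis (k i) \<Longrightarrow> coord x i b = 0"
  using phi_coset_in_carr[of x]
  by (auto simp: coord_def heisenberg_sum_def direct_sum_alg_def heisenberg_def PiE_iff)

text \<open>From right to left: an extensional function is determined by its values on
  \<open>{1..s}\<close>, and \<open>\<phi>\<close> is injective on cosets.\<close>

lemma diff_in_leib_iff: "x - y \<in> leib \<longleftrightarrow> (\<forall>i\<in>{1..s}. \<forall>b. coord x i b = coord y i b)"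
proof
  assume "x - y \<in> leib"
  then show "\<forall>i\<in>{1..s}. \<forall>b. coord x i b = coord y i b"
    by (simp add: coord_def flip: coset_eq_iff)
next
  assume eq: "\<forall>i\<in>{1..s}. \<forall>b. coord x i b = coord y i b"
  have "\<phi> (coset x) = \<phi> (coset y)"
  proof -
    have "\<phi> (coset z) \<in> (\<Pi>\<^sub>E i\<in>{1..s}. carr (heisenberg (k i)))" for z
      using phi_coset_in_carr[of z] by (simp add: heisenberg_sum_def direct_sum_alg_def)
    note this[of x] this[of y]
    moreover have "\<phi> (coset x) i = \<phi> (coset y) i" if "i \<in> {1..s}" for i
      using eq that by (auto simp: coord_def)
    ultimately show ?thesis by (rule PiE_ext)
  qed
  moreover have "inj_on \<phi> (range coset)"
    using phi_iso by (auto simp: alg_iso_def carr_lie_quotient bij_betw_def)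
  ultimately show "x - y \<in> leib"
    unfolding coset_eq_iff[symmetric] by (meson inj_onD rangeI)
qed

lemma coord_zero: "i \<in> {1..s} \<Longrightarrow> coord 0 i b = 0"
  using coord_scale[of i 0 0 b] by simp

lemma coord_sum: "i \<in> {1..s} \<Longrightarrow> coord (sum f A) i b = (\<Sum>a\<in>A. coord (f a) i b)"
  by (induction A rule: infinite_finite_induct) (simp_all add: coord_zero coord_add)

lemma in_leib_iff: "x \<in> leib \<longleftrightarrow> (\<forall>i\<in>{1..s}. \<forall>b. coord x i b = 0)"
  using diff_in_leib_iff[of x 0] by (simp add: coord_zero)

text \<open>A relation rather than a function, since a preimage of a basis vector of the quotient is
  determined only modulo \<open>leib\<close>.\<close>

definition lifts :: "nat \<Rightarrow> heis_ix \<Rightarrow> 'v \<Rightarrow> bool" where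
  "lifts i a x \<longleftrightarrow> (\<forall>j\<in>{1..s}. \<forall>b. coord x j b = (if j = i \<and> b = a then 1 else 0))"

lemma lift_exists:
  assumes "i \<in> {1..s}" "a \<in> heis_basis (k i)"
  shows "\<exists>x. lifts i a x"
proof -
  let ?v = "\<lambda>j\<in>{1..s}. \<lambda>b. if j = i \<and> b = a then 1 else (0::'f)"
  have "?v \<in> carr (heisenberg_sum s k)"
    using assms by (auto simp: heisenberg_sum_def direct_sum_alg_def heisenberg_def)
  then have "?v \<in> \<phi> ` range coset"
    using phi_iso by (simp add: alg_iso_def carr_lie_quotient bij_betw_def)
  then obtain x where "\<phi> (coset x) = ?v" by auto
  then have "lifts i a x" by (simp add: lifts_def coord_def)
  then show ?thesis ..
qed

lemma psi_eq_iff: "u \<in> leib \<Longrightarrow> v \<in> leib \<Longrightarrow> \<psi> u = \<psi> v \<longleftrightarrow> u = v"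
  using psi_bij by (auto simp: bij_betw_def inj_on_def)

lemma psi_bracket_lift:
  assumes "u \<in> leib" "i \<in> {1..s}" "a \<in> heis_basis (k i)" "lifts i a x"
  shows "\<psi> (bracket u x) = fock_gen k i (\<psi> u) a"
proof -
  have "\<psi> (bracket u x) = (\<Sum>j\<in>{1..s}. \<Sum>b\<in>heis_basis (k j).
      pscale (if j = i \<and> b = a then 1 else 0) (fock_gen k j (\<psi> u) b))"
    using assms(1,4) by (simp add: psi_bracket fock_def lifts_def flip: coord_def)
  also have "\<dots> = fock_gen k i (\<psi> u) a"
    using assms(2,3) finite_heis_basis by (intro sum_sum_pscale_delta) auto
  finally show ?thesis .
qed

lemma psi_sum: "(\<And>a. a \<in> A \<Longrightarrow> f a \<in> leib) \<Longrightarrow> \<psi> (sum f A) = (\<Sum>a\<in>A. \<psi> (f a))"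
proof -
  have psi_0: "\<psi> 0 = 0"
    using psi_scale[OF subspace_0[OF subspace_leib], of 0] by (simp add: pscale_0)
  show "(\<And>a. a \<in> A \<Longrightarrow> f a \<in> leib) \<Longrightarrow> \<psi> (sum f A) = (\<Sum>a\<in>A. \<psi> (f a))"
    by (induction A rule: infinite_finite_induct)
      (simp_all add: psi_0 psi_add subspace_sum[OF subspace_leib])
qed

text \<open>Without summands there are no coordinates to test, so \<open>leib\<close> is the whole
  algebra and hence zero. This contradicts its bijection with a space of polynomials.\<close>

lemma summands_nonempty: "1 \<in> {1..s}"
proof (rule ccontr)
  assume "1 \<notin> {1..s}"
  then have "leib = UNIV" by (auto simp: in_leib_iff)
  then have triv: "x = 0" for x :: 'v by (rule leib_eq_UNIV_imp_trivial)
  \<comment> \<open>The constants 0 and 1 are polynomials even in zero variables.\<close>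
  have "0 \<in> \<psi> ` leib" "Poly_Mapping.single 0 1 \<in> \<psi> ` leib"
    using psi_bij by (auto simp: bij_betw_def polys_def exponents_def)
  then obtain u v where "\<psi> u = 0" "\<psi> v = Poly_Mapping.single 0 1" by (auto simp: image_iff)
  moreover have "u = v" using triv[of u] triv[of v] by simp
  ultimately have "Poly_Mapping.lookup (Poly_Mapping.single 0 (1::'f)) (0 :: nat \<Rightarrow>\<^sub>0 nat) = 0"
    by (metis lookup_zero)
  then show False by simp
qed

text \<open>The central basis vector acts as the identity on polynomials, and its products in the
  Heisenberg algebra are zero.\<close>

lemma central_lift_unit:
  assumes "i \<in> {1..s}" "lifts i One c"
  shows "leibniz_unit scale bracket c"
proof
  have One: "One \<in> heis_basis (k i)" by (simp add: heis_basis_def)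
  show "bracket u c = u" if "u \<in> leib" for u
    using psi_bracket_lift[OF that assms(1) One assms(2)] psi_eq_iff bracket_leib_left that by simp
  show "bracket x c \<in> leib" for x
    unfolding in_leib_iff
  proof (intro ballI allI)
    fix j d assume j: "j \<in> {1..s}"
    \<comment> \<open>For \<open>b = One\<close> the table entry vanishes, for any other
      \<open>b\<close> the coordinate of \<open>c\<close> does.\<close>
    have zero: "coord x j a * coord c j b * heis_table a b d = 0" for a b
      using assms(2) j by (cases "b = One"; cases a) (simp_all add: lifts_def)
    then show "coord (bracket x c) j d = 0"
      by (simp only: coord_bracket[OF j] zero sum.neutral_const)
  qed
qed

lemma coord_bracket_lifts:
  assumes "lifts i a x" "lifts i' b y" "a \<in> heis_basis (k i)" "b \<in> heis_basis (k i')" "j \<in> {1..s}"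
  shows "coord (bracket x y) j d = (if i = i' \<and> j = i then heis_table a b d else 0)"
proof -
  have "coord (bracket x y) j d = (\<Sum>a'\<in>heis_basis (k j). \<Sum>b'\<in>heis_basis (k j).
      if b' = b then if a' = a then if i = i' \<and> j = i then heis_table a b d else 0 else 0 else 0)"
    unfolding coord_bracket[OF assms(5)]
    using assms(1,2,5) by (intro sum.cong refl) (auto simp: lifts_def)
  then show ?thesis
    using assms(3,4) by (cases "i = i' \<and> j = i") (auto simp: finite_heis_basis intro!: sum.neutral)
qed

section \<open>The adapted basis and its multiplication table\<close>

lemma hfl_basis_exists:
  "\<exists>e. inj_on e (hfl_basis s k) \<and> independent (e ` hfl_basis s k) \<and>
    span (e ` hfl_basis s k) = UNIV \<and>
    (\<forall>a\<in>hfl_basis s k. \<forall>b\<in>hfl_basis s k. bracket (e a) (e b) = hfl_table scale k e a b)"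
proof -
  let ?n = "\<Sum>i\<in>{1..s}. k i" and ?B = "hfl_basis s k"
  have "One \<in> heis_basis (k 1)" by (simp add: heis_basis_def)
  then obtain c where c: "lifts 1 One c" using lift_exists summands_nonempty by blast
  interpret leibniz_unit scale bracket c
    using central_lift_unit[OF summands_nonempty c] .
  \<comment> \<open>An arbitrary lift is corrected by its \<open>leib\<close> component
    \<open>[y,c]\<close>. It remains a lift and now lies in the kernel of right multiplication by
    \<open>c\<close>.\<close>
  define h where "h i a = (let y = SOME y. lifts i a y in y - bracket y c)" for i a
  define m where "m t = inv_into leib \<psi> (Poly_Mapping.single t 1)" for t
  define e where "e = case_hfl_ix h m"
  have h_ker: "bracket (h i a) c = 0" for i a
    by (simp add: h_def Let_def unit_complement)
  have h_lifts: "lifts i a (h i a)" if "i \<in> {1..s}" "a \<in> heis_basis (k i)" for i a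
  proof -
    define y where "y = (SOME y. lifts i a y)"
    have "lifts i a y" unfolding y_def using lift_exists[OF that] by (rule someI_ex)
    moreover have "h i a - y \<in> leib"
      using subspace_neg[OF subspace_leib bracket_unit_in_leib[of y]] by (simp add: h_def y_def Let_def)
    ultimately show ?thesis by (simp add: lifts_def diff_in_leib_iff)
  qed
  have m_leib: "m t \<in> leib" and psi_m: "\<psi> (m t) = Poly_Mapping.single t 1"
    if "t \<in> exponents ?n" for t
    using psi_bij single_in_polys[OF that, of 1]
    unfolding m_def bij_betw_def by (metis inv_into_into, metis f_inv_into_f)
  note mem_B = hfl_basis_def image_iff

  \<comment> \<open>The dual functionals. As \<open>\<psi>\<close> is controlled only on
    \<open>leib\<close>, the monomial coefficients are read off the projection \<open>[x,c]\<close>,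
    which is zero on every \<open>h i a\<close>.\<close>
  define f where "f = case_hfl_ix (\<lambda>i a x. coord x i a)
    (\<lambda>t x. Poly_Mapping.lookup (\<psi> (bracket x c)) t)"
  have f_add: "f a (x + y) = f a x + f a y" if "a \<in> ?B" for a x y
    using that by (auto simp: f_def mem_B coord_add bracket_add_left psi_add bracket_unit_in_leib lookup_add)
  have f_scale: "f a (scale r x) = r * f a x" if "a \<in> ?B" for a r x
    using that by (auto simp: f_def mem_B coord_scale bracket_scale_left psi_scale
        bracket_unit_in_leib lookup_pscale)
  have psi_0: "\<psi> 0 = 0" using psi_sum[of "{}"] by simp
  have f_dual: "f a (e b) = (if a = b then 1 else 0)" if ab: "a \<in> ?B" "b \<in> ?B" for a b
  proof (cases b)
    case (H i' b')
    then have "lifts i' b' (h i' b')" using ab h_lifts by (auto simp: mem_B)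
    then show ?thesis using ab H
      by (cases a) (auto simp: f_def e_def mem_B lifts_def h_ker psi_0)
  next
    case (Mon t)
    then have "m t \<in> leib" "\<psi> (m t) = Poly_Mapping.single t 1"
      using ab m_leib psi_m by (auto simp: mem_B)
    then show ?thesis using ab Mon
      by (cases a) (auto simp: f_def e_def mem_B in_leib_iff bracket_unit_leib lookup_single when_def)
  qed
  note indep = dual_family_imp_independent[of ?B f e, OF f_add f_scale f_dual]

  \<comment> \<open>The expansion of \<open>\<psi> u\<close> into monomials is pulled back through
    the injectivity of \<open>\<psi>\<close> on \<open>leib\<close>.\<close>
  have span_leib: "u \<in> span (e ` ?B)" if u: "u \<in> leib" for u
  proof -
    let ?K = "Poly_Mapping.keys (\<psi> u)"
    have K: "t \<in> exponents ?n" if "t \<in> ?K" for t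
      using that u psi_bij by (auto simp: bij_betw_def polys_def)
    note mK = m_leib[OF K] psi_m[OF K]
    have sl: "(\<Sum>t\<in>?K. scale (Poly_Mapping.lookup (\<psi> u) t) (m t)) \<in> leib"
      using mK subspace_leib by (intro subspace_sum) (auto intro: subspace_scale)
    have "\<psi> (\<Sum>t\<in>?K. scale (Poly_Mapping.lookup (\<psi> u) t) (m t))
        = (\<Sum>t\<in>?K. Poly_Mapping.single t (Poly_Mapping.lookup (\<psi> u) t))"
      by (subst psi_sum)
        (auto simp: mK psi_scale pscale_single subspace_scale[OF subspace_leib])
    then have eq: "u = (\<Sum>t\<in>?K. scale (Poly_Mapping.lookup (\<psi> u) t) (m t))"
      using psi_eq_iff[OF u sl] poly_mapping_eq_sum_single[of "\<psi> u"] by simp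
    have "m t \<in> e ` ?B" if "t \<in> ?K" for t
      using K[OF that] by (auto simp: e_def mem_B intro!: bexI[of _ "Mon t"])
    then show ?thesis
      by (subst eq) (intro span_sum span_scale span_base)
  qed
  have span_ker: "x \<in> span (e ` ?B)" if x: "bracket x c = 0" for x
  proof -
    \<comment> \<open>The combination of the \<open>h i b\<close> with the coordinates of
      \<open>x\<close>. It is congruent to \<open>x\<close> modulo \<open>leib\<close>, and both lie
      in the kernel, so they agree.\<close>
    let ?z = "\<Sum>i\<in>{1..s}. \<Sum>b\<in>heis_basis (k i). scale (coord x i b) (h i b)"
    have "?z \<in> {x. bracket x c = 0}"
      by (intro subspace_sum subspace_scale subspace_unit_kernel) (simp add: h_ker)
    moreover have "x - ?z \<in> leib"
      unfolding diff_in_leib_iff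
    proof (intro ballI allI)
      fix j d assume j: "j \<in> {1..s}"
      have "coord ?z j d = (\<Sum>i\<in>{1..s}. \<Sum>b\<in>heis_basis (k i).
          coord x i b * (if j = i \<and> d = b then 1 else 0))"
        using h_lifts j by (simp add: coord_sum coord_scale lifts_def)
      also have "\<dots> = (\<Sum>i\<in>{1..s}. if j = i then
          (\<Sum>b\<in>heis_basis (k j). if d = b then coord x j b else 0) else 0)"
        by (intro sum.cong refl) (auto intro!: sum.cong)
      also have "\<dots> = coord x j d"
        \<comment> \<open>For \<open>d\<close> outside the standard basis the sum is empty of
          contributions, and \<open>coord x j d\<close> is zero too.\<close>
        using j coord_outside[OF j, of d x] by (simp add: finite_heis_basis)
      finally show "coord x j d = coord ?z j d" by simp
    qed
    ultimately have eq: "x = ?z" using x unit_kernel_eqI by simp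
    have "h i b \<in> e ` ?B" if "i \<in> {1..s}" "b \<in> heis_basis (k i)" for i b
      using that by (auto simp: e_def mem_B intro!: bexI[of _ "H i b"])
    then show ?thesis
      by (subst eq) (intro span_sum span_scale span_base)
  qed
  \<comment> \<open>The decomposition is \<open>x = [x,c] + (x - [x,c])\<close>.\<close>
  have "x \<in> span (e ` ?B)" for x
    using span_add[OF span_leib[OF bracket_unit_in_leib[of x]] span_ker[OF unit_complement[of x]]]
    by simp
  then have span_UNIV: "span (e ` ?B) = UNIV" by auto

  \<comment> \<open>Both sides lie in the kernel of right multiplication by \<open>c\<close>, so it
    suffices to compare their coordinates in the quotient.\<close>
  have HH: "bracket (h i a) (h i' b) = hfl_table scale k e (H i a) (H i' b)"
    if "i \<in> {1..s}" "a \<in> heis_basis (k i)" "i' \<in> {1..s}" "b \<in> heis_basis (k i')" for i a i' b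
  proof (rule unit_kernel_eqI)
    show "bracket (bracket (h i a) (h i' b)) c = 0"
      by (simp add: unit_kernel_bracket h_ker)
    show "bracket (hfl_table scale k e (H i a) (H i' b)) c = 0"
      using bracket_scale_left[of "-1" _ c]
      by (cases a; cases b) (simp_all add: hfl_table_def e_def h_ker bracket_zero_left)
    have One: "coord (h i One) j d = unit_vec One d * (if j = i then 1 else 0)"
      if "i \<in> {1..s}" "j \<in> {1..s}" for i j d
      using h_lifts[OF that(1), of One] that
      by (auto simp: heis_basis_def lifts_def unit_vec_def)
    have neg: "coord (- x) j d = - coord x j d" if "j \<in> {1..s}" for x j d
      using coord_scale[OF that, of "-1" x d] by simp
    show "bracket (h i a) (h i' b) - hfl_table scale k e (H i a) (H i' b) \<in> leib"
      unfolding diff_in_leib_iff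
    proof (intro ballI allI)
      fix j d assume j: "j \<in> {1..s}"
      show "coord (bracket (h i a) (h i' b)) j d = coord (hfl_table scale k e (H i a) (H i' b)) j d"
        unfolding coord_bracket_lifts[OF h_lifts[OF that(1,2)] h_lifts[OF that(3,4)] that(2,4) j]
        using j that by (cases a; cases b) (simp_all add: hfl_table_def e_def coord_zero neg One)
    qed
  qed
  \<comment> \<open>Both sides lie in \<open>leib\<close>, so the comparison takes place among
    polynomials, where \<open>h i b\<close> acts by a single Fock generator.\<close>
  have MH: "bracket (m t) (h i b) = hfl_table scale k e (Mon t) (H i b)"
    if t: "t \<in> exponents ?n" and i: "i \<in> {1..s}" and b: "b \<in> heis_basis (k i)" for t i b
  proof -
    note p = psi_bracket_lift[OF m_leib[OF t] i b h_lifts[OF i b]]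
    note l = bracket_leib_left[OF m_leib[OF t], of "h i b"]
    show ?thesis
    proof (cases b)
      case One
      then show ?thesis using p l t by (simp add: hfl_table_def e_def psi_eq_iff m_leib)
    next
      case (X j)
      then have "j \<in> {1..k i}" using b by (auto simp: heis_basis_def)
      then have t': "t + Poly_Mapping.single (var_ix k i j) 1 \<in> exponents ?n"
        using exponents_add_single[OF t] var_ix_in_range[OF i] by blast
      have "\<psi> (bracket (m t) (h i b)) = \<psi> (m (t + Poly_Mapping.single (var_ix k i j) 1))"
        using p X unfolding psi_m[OF t'] by (simp add: psi_m[OF t] pvar_def mult_single)
      then show ?thesis using X l psi_eq_iff m_leib[OF t'] by (simp add: hfl_table_def e_def)
    next
      case (D j)
      \<comment> \<open>If the variable does not occur in \<open>t\<close>, truncation leaves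
        \<open>?t = t\<close>, but the factor \<open>?r\<close> is then 0.\<close>
      let ?t = "t - Poly_Mapping.single (var_ix k i j) 1"
      let ?r = "of_nat (Poly_Mapping.lookup t (var_ix k i j))"
      have t': "?t \<in> exponents ?n" by (rule exponents_diff[OF t])
      have "\<psi> (bracket (m t) (h i b)) = \<psi> (scale ?r (m ?t))"
        using p D unfolding psi_scale[OF m_leib[OF t']] psi_m[OF t']
        by (simp add: psi_m[OF t] partial_single pscale_single)
      then show ?thesis
        using D l psi_eq_iff subspace_scale[OF subspace_leib m_leib[OF t']]
        by (simp add: hfl_table_def e_def)
    qed
  qed
  have table: "bracket (e a) (e b) = hfl_table scale k e a b" if "a \<in> ?B" "b \<in> ?B" for a b
  proof (cases b)
    case (H i b')
    show ?thesis
      using that H HH MH by (cases a) (auto simp: e_def mem_B)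
  next
    case (Mon t)
    \<comment> \<open>The right factor lies in \<open>leib\<close>, which annihilates from the
      right; the table has only zeros in these columns.\<close>
    have "bracket (e a) (e b) = 0"
      using that Mon m_leib by (auto simp: e_def mem_B bracket_leib_right)
    moreover have "hfl_table scale k e a b = 0"
      using Mon by (cases a; cases "\<exists>i j. a = H i j") (auto simp: hfl_table_def split: heis_ix.splits)
    ultimately show ?thesis by simp
  qed
  show ?thesis using indep span_UNIV table by blast
qed

end

theorem theorem2:
  fixes scale :: "'f::{alg_closed_field, field_char_0} \<Rightarrow> 'v::ab_group_add \<Rightarrow> 'v"
    and bracket :: "'v \<Rightarrow> 'v \<Rightarrow> 'v"
    and s :: nat and k :: "nat \<Rightarrow> nat"
  assumes "heisenberg_fock scale bracket s k"
  shows "\<exists>e :: hfl_ix \<Rightarrow> 'v.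
    inj_on e (hfl_basis s k) \<and>
    \<not> module.dependent scale (e ` hfl_basis s k) \<and>
    module.span scale (e ` hfl_basis s k) = UNIV \<and>
    (\<forall>a\<in>hfl_basis s k. \<forall>b\<in>hfl_basis s k.
       bracket (e a) (e b) = hfl_table scale k e a b)"
proof -
  interpret heisenberg_fock scale bracket s k by fact
  \<comment> \<open>The isomorphisms become fixed parameters, since the basis is built from a
    particular choice of them.\<close>
  have "\<exists>\<phi> \<psi>. heisenberg_fock_iso scale bracket s k \<phi> \<psi>"
    using quotient_and_module_iso leibniz_algebra_axioms
    unfolding heisenberg_fock_iso_def heisenberg_fock_iso_axioms_def by blast
  then obtain \<phi> \<psi> where "heisenberg_fock_iso scale bracket s k \<phi> \<psi>" by blast
  then show ?thesis by (rule heisenberg_fock_iso.hfl_basis_exists)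
qed

end
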